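(* Let $\langle X,\tau\rangle$ be a regular $T_1$ topological space and let $f:\mathbb{S}\to\langle X,\tau\rangle$ be a continuous open surjection. If $\mathsf{w}(\langle X,\tau\rangle)>\omega$, then there exists a closed subset of $\langle X,\tau\rangle$ that (with the subspace topology) is homeomorphic to the Sorgenfrey line $\mathbb{S}$.
   Context: The Sorgenfrey line $\mathbb{S}$ is the set $\mathbb{R}$ with the topology $\tau_{\mathbb{S}}$ generated by the half-open intervals $\{[a,b): a,b\in\mathbb{R}\}$. A continuous map is called open if the image of every open set under it is open. $\mathsf{w}(\langle X,\tau\rangle)$ denotes the weight of $\langle X,\tau\rangle$, i.e. the least cardinality of a base of the topology $\tau$; $\mathsf{w}(\langle X,\tau\rangle)>\omega$ means that the space has no countable base. *)

theory Defs
  imports "HOL-Analysis.Analysis"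
begin

definition sorgenfrey_line :: "real topology"
  where "sorgenfrey_line = topology_generated_by {{a..<b} | a b. True}"

lemma topspace_sorgenfrey_line [simp]: "topspace sorgenfrey_line = UNIV"
proof -
  have "x \<in> {x..<x + 1}" for x :: real
    by simp
  then show ?thesis
    unfolding sorgenfrey_line_def topspace_def openin_topology_generated_by_iff
    by (blast intro: generate_topology_on.Basis)
qed

end

theory Submission
  imports Defs
begin

text \<open>
  If \<open>X\<close> has no countable base, then uncountably many \<open>x\<close> satisfy \<open>f x \<notin> f ` {x<..<d}\<close> for some
  \<open>d > x\<close>. By regularity there are \<open>M' < M\<close> and an uncountable set of \<open>z < M'\<close> with
  \<open>f z \<notin> f ` {z<..<M}\<close> and \<open>closure (f ` {z..<M'}) \<subseteq> f ` {z..<M}\<close>. Fill this set by a strictly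
  increasing right-continuous \<open>e\<close> on \<open>[0, 1)\<close> and put \<open>g = f \<circ> e\<close>. The open sets
  \<open>V k = f ` {e k..<M}\<close> cut out exactly the final segments of \<open>g\<close>, so that \<open>g\<close> embeds the
  Sorgenfrey interval \<open>[0, 1)\<close> in \<open>X\<close>.

  Let \<open>A\<close> be the closure of the image of \<open>g\<close>. If the image contains a relatively open piece of
  \<open>A\<close> around one of its points, some portion \<open>g ` {t..<d}\<close> is closed, and it is a copy of the line.
  Otherwise the points of \<open>A\<close> outside the image are dense in \<open>A\<close>; they behave like limits of \<open>g\<close>
  from the left. Along \<open>E = {u. f u \<in> A}\<close> the position \<open>{k. f u \<in> V k}\<close> then has a local
  minimum from the right at points of the first kind and a local maximum at points of the second
  kind, and the Baire property of the Sorgenfrey-closed set \<open>E\<close> makes one of the two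
  uniform on a portion of \<open>E\<close>, which contradicts the density of both kinds.
\<close>

section \<open>The Sorgenfrey topology\<close>

text \<open>A basic interval around \<open>x\<close> contains a basic interval starting at
  \<open>x\<close>, so neighbourhoods to the right of the point suffice.\<close>

lemma openin_sorgenfrey_line:
  "openin sorgenfrey_line U \<longleftrightarrow> (\<forall>x\<in>U. \<exists>b>x. {x..<b} \<subseteq> U)"
proof
  assume "openin sorgenfrey_line U"
  then have "generate_topology_on {{a..<b} | a b :: real. True} U"
    by (simp add: sorgenfrey_line_def openin_topology_generated_by_iff)
  then show "\<forall>x\<in>U. \<exists>b>x. {x..<b} \<subseteq> U"
  proof induction
    case (Int U V)
    show ?case
    proof
      fix x assume "x \<in> U \<inter> V"
      with Int.IH obtain b c where "b > x" "{x..<b} \<subseteq> U" "c > x" "{x..<c} \<subseteq> V"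
        by blast
      then show "\<exists>b>x. {x..<b} \<subseteq> U \<inter> V"
        by (intro exI[of _ "min b c"]) auto
    qed
  next
    case (UN K)
    then show ?case by (meson Union_iff Union_upper order_trans)
  qed auto
next
  assume *: "\<forall>x\<in>U. \<exists>b>x. {x..<b} \<subseteq> U"
  have "openin sorgenfrey_line {a..<b}" for a b
    unfolding sorgenfrey_line_def openin_topology_generated_by_iff
    by (blast intro: generate_topology_on.Basis)
  moreover have "\<exists>V. openin sorgenfrey_line V \<and> x \<in> V \<and> V \<subseteq> U" if x: "x \<in> U" for x
  proof -
    obtain b where "b > x" "{x..<b} \<subseteq> U"
      using * x by blast
    then show ?thesis
      using calculation by (intro exI[of _ "{x..<b}"]) auto
  qed
  ultimately show "openin sorgenfrey_line U"
    by (subst openin_subopen) blast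
qed

lemma openin_sorgenfrey_line_atLeastLessThan: "openin sorgenfrey_line {a..<b}"
  by (auto simp: openin_sorgenfrey_line)

lemma sorgenfrey_nhd:
  assumes "continuous_map sorgenfrey_line X f" "openin X U" "f x \<in> U"
  obtains b where "b > x" "f ` {x..<b} \<subseteq> U"
proof -
  have "openin sorgenfrey_line {x. f x \<in> U}"
    using openin_continuous_map_preimage[OF assms(1,2)] by simp
  with assms(3) show ?thesis
    unfolding openin_sorgenfrey_line by (metis (mono_tags, lifting) image_subsetI mem_Collect_eq subsetD that)
qed

lemma regular_nhd:
  assumes "regular_space X" "openin X U" "x \<in> U"
  obtains V where "openin X V" "x \<in> V" "X closure_of V \<subseteq> U"
proof -
  obtain V C where "openin X V" "closedin X C" "x \<in> V" "V \<subseteq> C" "C \<subseteq> U"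
    using assms neighbourhood_base_of_closedin[of X] unfolding neighbourhood_base_of by metis
  then show ?thesis
    using that closure_of_minimal by (metis order_trans)
qed

text \<open>Category argument with nested closed intervals: if no \<open>D n\<close> is dense from
  the right in a portion of \<open>E\<close>, the intervals can avoid the sets \<open>D n\<close>
  one by one. Closedness of \<open>E\<close> puts their common point into \<open>E\<close>, where no
  \<open>D n\<close> is left to cover it.\<close>

lemma sorgenfrey_baire:
  fixes D :: "nat \<Rightarrow> real set"
  assumes "closedin sorgenfrey_line E"
    and crowded: "\<And>x b. x \<in> E \<Longrightarrow> x < b \<Longrightarrow> \<exists>y\<in>E. x < y \<and> y < b"
    and "E \<noteq> {}" and cover: "E \<subseteq> (\<Union>n. D n)"
  obtains n a b where "a \<in> E" "a < b"
    "\<And>x c. x \<in> E \<Longrightarrow> a \<le> x \<Longrightarrow> x < b \<Longrightarrow> x < c \<Longrightarrow> \<exists>d\<in>D n. x \<le> d \<and> d < c"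
proof (rule ccontr)
  note that' = that
  assume "\<not> thesis"
  then have nd: "\<exists>x\<in>E. \<exists>c>x. a \<le> x \<and> x < b \<and> {x..<c} \<inter> D n = {}" if "a \<in> E" "a < b" for n a b
    using that \<open>\<not> thesis\<close> that' by (metis atLeastLessThan_iff disjoint_iff)
  \<comment> \<open>Both endpoints are kept in \<open>E\<close>; the right ones are needed for the
    limit, as Sorgenfrey convergence is from the right.\<close>
  define ok where "ok p \<longleftrightarrow> fst p \<in> E \<and> snd p \<in> E \<and> fst p < snd p" for p :: "real \<times> real"
  have step: "\<exists>q. ok q \<and> fst p \<le> fst q \<and> snd q \<le> snd p \<and> {fst q..snd q} \<inter> D n = {}
      \<and> snd q - fst q < 1 / real (Suc n)"
    if p: "ok p" for p n
  proof -
    obtain x c where x: "x \<in> E" "x < c" "fst p \<le> x" "x < snd p" "{x..<c} \<inter> D n = {}"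
      using nd[of "fst p" "snd p" n] p unfolding ok_def by blast
    \<comment> \<open>The three bounds keep the new interval off \<open>D n\<close>, inside the old
      one, and short.\<close>
    obtain y where "y \<in> E" "x < y" "y < min (min c (snd p)) (x + 1 / real (Suc n))"
      using crowded[OF x(1), of "min (min c (snd p)) (x + 1 / real (Suc n))"] x by auto
    with x show ?thesis
      unfolding ok_def by (intro exI[of _ "(x, y)"]) (auto simp: disjoint_iff)
  qed
  obtain p0 where "ok p0"
  proof -
    obtain x where "x \<in> E" using assms(3) by blast
    moreover obtain y where "y \<in> E" "x < y" using crowded[OF \<open>x \<in> E\<close>, of "x + 1"] by auto
    ultimately show ?thesis using that[of "(x, y)"] by (simp add: ok_def)
  qed
  define good where "good n p q \<longleftrightarrow> ok q \<and> fst p \<le> fst q \<and> snd q \<le> snd p \<and> {fst q..snd q} \<inter> D n = {}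
      \<and> snd q - fst q < 1 / real (Suc n)" for n and p q :: "real \<times> real"
  obtain p where p: "\<And>n. ok (p n)" "\<And>n. good n (p n) (p (Suc n))"
    using dependent_nat_choice[of "\<lambda>_. ok" good] step \<open>ok p0\<close> unfolding good_def by metis
  have "incseq (fst \<circ> p)" "decseq (snd \<circ> p)"
    using p(2) by (auto simp: incseq_Suc_iff decseq_Suc_iff good_def)
  then have le: "fst (p m) \<le> snd (p n)" for m n
    using p(1)[of "max m n"] by (smt (verit, best) comp_apply decseqD incseqD max.cobounded1 max.cobounded2 ok_def)
  define s where "s = (SUP n. fst (p n))"
  have s: "fst (p n) \<le> s" "s \<le> snd (p n)" for n
    unfolding s_def using le by (auto intro!: cSUP_upper cSUP_least bdd_aboveI2)
  \<comment> \<open>The right endpoints lie in \<open>E\<close> and approach \<open>s\<close> from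
    the right.\<close>
  have "s \<in> E"
  proof (rule ccontr)
    assume "s \<notin> E"
    then obtain b where b: "b > s" "{s..<b} \<subseteq> - E"
      using assms(1) by (auto simp: closedin_def openin_sorgenfrey_line Compl_eq_Diff_UNIV)
    obtain n where "1 / real (Suc n) < b - s"
      using reals_Archimedean[of "b - s"] b(1) by (auto simp: inverse_eq_divide)
    moreover have "snd (p (Suc n)) - fst (p (Suc n)) < 1 / real (Suc n)" "snd (p (Suc n)) \<in> E"
      using p(2)[of n] by (auto simp: good_def ok_def)
    ultimately show False
      using s[of "Suc n"] b(2) by (auto simp: subset_iff)
  qed
  then obtain n where "s \<in> D n" using cover by blast
  then show False
    using p(2)[of n] s[of "Suc n"] by (auto simp: good_def disjoint_iff)
qed

section \<open>Half-open intervals as copies of the Sorgenfrey line\<close>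

lemma sorgenfrey_homeomorphism:
  fixes r :: "real \<Rightarrow> real"
  assumes r: "inj r" "range r = S"
    and cont: "\<And>x c. r x < c \<Longrightarrow> \<exists>b>x. r ` {x..<b} \<subseteq> {r x..<c}"
    and op: "\<And>x b. x < b \<Longrightarrow> \<exists>c>r x. {r x..<c} \<subseteq> r ` {x..<b}"
  shows "sorgenfrey_line homeomorphic_space subtopology sorgenfrey_line S"
proof -
  have "homeomorphic_map sorgenfrey_line (subtopology sorgenfrey_line S) r"
  proof (rule bijective_open_imp_homeomorphic_map)
    have "openin sorgenfrey_line {x. r x \<in> U}" if U: "openin sorgenfrey_line U" for U
      unfolding openin_sorgenfrey_line
    proof
      fix x assume "x \<in> {x. r x \<in> U}"
      then obtain c where c: "c > r x" "{r x..<c} \<subseteq> U"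
        using U by (auto simp: openin_sorgenfrey_line)
      then obtain b where "b > x" "r ` {x..<b} \<subseteq> {r x..<c}" using cont by blast
      with c show "\<exists>b>x. {x..<b} \<subseteq> {x. r x \<in> U}" by blast
    qed
    then have "continuous_map sorgenfrey_line sorgenfrey_line r"
      by (simp add: continuous_map)
    then show "continuous_map sorgenfrey_line (subtopology sorgenfrey_line S) r"
      using r(2) by (auto simp: continuous_map_in_subtopology)
    have "openin sorgenfrey_line (r ` U)" if U: "openin sorgenfrey_line U" for U
      unfolding openin_sorgenfrey_line
    proof
      fix y assume "y \<in> r ` U"
      then obtain x where x: "x \<in> U" "y = r x" by blast
      then obtain b where b: "b > x" "{x..<b} \<subseteq> U"
        using U by (auto simp: openin_sorgenfrey_line)
      then obtain c where "c > r x" "{r x..<c} \<subseteq> r ` {x..<b}" using op by blast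
      with b x show "\<exists>b>y. {y..<b} \<subseteq> r ` U" by (meson image_mono order_trans)
    qed
    moreover have "r ` U \<subseteq> S" for U using r(2) by blast
    ultimately show "open_map sorgenfrey_line (subtopology sorgenfrey_line S) r"
      by (intro open_map_into_subtopology) (auto simp: open_map_def)
  qed (use r in auto)
  then show ?thesis by (rule homeomorphic_map_imp_homeomorphic_space)
qed

text \<open>The line and the half-line \<open>[0, \<infinity>)\<close> are both countable sums of half-open unit intervals, matched
  by a bijection \<open>s\<close> of the integer parts; \<open>h\<close> then maps the half-line increasingly onto \<open>[t, d)\<close>.\<close>

lemma sorgenfrey_line_homeomorphic_atLeastLessThan:
  assumes "t < d"
  shows "sorgenfrey_line homeomorphic_space subtopology sorgenfrey_line {t..<d}"
proof -
  define s :: "int \<Rightarrow> nat" where "s = int_encode"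
  have s: "inj s" "surj s" unfolding s_def by (simp_all add: inj_int_encode surj_int_encode)
  \<comment> \<open>\<open>p\<close> translates each cell between consecutive integers onto the cell
    numbered by \<open>s\<close>, so it is increasing inside a cell although not globally.\<close>
  define p where "p x = real (s \<lfloor>x\<rfloor>) + frac x" for x :: real
  have floor_p: "\<lfloor>p x\<rfloor> = int (s \<lfloor>x\<rfloor>)" for x
    unfolding p_def using frac_lt_1[of x] frac_ge_0[of x] by (intro floor_unique) simp_all
  have frac_p: "frac (p x) = frac x" for x
    using floor_p[of x] unfolding frac_def[of "p x"] by (simp add: p_def)
  have p_inj: "inj p"
  proof (rule injI)
    fix x y assume "p x = p y"
    then have "\<lfloor>x\<rfloor> = \<lfloor>y\<rfloor>" "frac x = frac y"
      using floor_p frac_p s(1) by (metis injD of_nat_eq_iff)+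
    then show "x = y" by (simp add: frac_def)
  qed
  have p_nonneg: "0 \<le> p x" for x by (simp add: p_def)
  have p_translate: "p y = p x + (y - x)" if "x \<le> y" "y < real_of_int \<lfloor>x\<rfloor> + 1" for x y :: real
  proof -
    have "\<lfloor>y\<rfloor> = \<lfloor>x\<rfloor>" using that by linarith
    then show ?thesis by (simp add: p_def frac_def)
  qed
  have p_surj: "\<exists>x. p x = v" if "0 \<le> v" for v
  proof -
    obtain i where i: "s i = nat \<lfloor>v\<rfloor>" using s(2) by (metis surjD)
    have "p (real_of_int i + frac v) = v"
      using i that by (simp add: p_def frac_lt_1 floor_add frac_frac) (simp add: frac_def)
    then show ?thesis by blast
  qed
  define h where "h v = d - (d - t) / (v + 1)" for v :: real
  define h' where "h' w = (d - t) / (d - w) - 1" for w :: real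
  have h_mono: "h v < h w" if "0 \<le> v" "v < w" for v w
    using that assms by (simp add: h_def frac_less2)
  have h_range: "t \<le> h v" "h v < d" if "0 \<le> v" for v
  proof -
    have "(d - t) / (v + 1) \<le> (d - t) / 1"
      using that assms by (intro divide_left_mono) auto
    then show "t \<le> h v" by (simp add: h_def)
    show "h v < d" using that assms by (simp add: h_def)
  qed
  have h_h': "h (h' w) = w" "0 \<le> h' w" if "t \<le> w" "w < d" for w
    using that assms by (simp_all add: h_def h'_def field_simps)
  have h_less: "v < w" if "h v < h w" "0 \<le> w" for v w
    using h_mono[of w v] that by (metis linorder_less_linear order_less_asym)
  define r where "r = h \<circ> p"
  show ?thesis
  proof (rule sorgenfrey_homeomorphism[of r])
    have "inj_on h (range p)"
      by (rule inj_onI) (metis h_mono p_nonneg imageE linorder_less_linear order_less_irrefl)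
    then show "inj r"
      unfolding r_def by (rule comp_inj_on[OF p_inj])
    have "w \<in> range r" if "t \<le> w" "w < d" for w
      using p_surj[OF h_h'(2)[OF that]] h_h'(1)[OF that] unfolding r_def by (metis comp_apply rangeI)
    then show "range r = {t..<d}"
      using h_range p_nonneg by (auto simp: r_def)
  next
    fix x c assume c: "r x < c"
    have "t \<le> r x" "r x < d"
      using h_range[OF p_nonneg[of x]] by (auto simp: r_def)
    \<comment> \<open>The midpoint keeps \<open>c'\<close> below \<open>d\<close>, where the inverse
      \<open>h'\<close> of \<open>h\<close> is available.\<close>
    define c' where "c' = min c ((r x + d) / 2)"
    have c': "r x < c'" "c' \<le> c" "t \<le> c'" "c' < d"
      using c \<open>t \<le> r x\<close> \<open>r x < d\<close> by (auto simp: c'_def min_def)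
    have "p x < h' c'"
      using h_less[of "p x" "h' c'"] h_h'[OF c'(3,4)] c'(1) by (simp add: r_def)
    define b where "b = min (real_of_int \<lfloor>x\<rfloor> + 1) (x + (h' c' - p x))"
    have "x < b" using \<open>p x < h' c'\<close> by (simp add: b_def)
    moreover have "r y \<in> {r x..<c}" if y: "y \<in> {x..<b}" for y
    proof -
      have py: "p y = p x + (y - x)" using y by (intro p_translate) (auto simp: b_def)
      then have "p x \<le> p y" "p y < h' c'" using y by (auto simp: b_def)
      then have "r x \<le> r y" "r y < c'"
        using h_mono[of "p x" "p y"] h_mono[of "p y" "h' c'"] h_h'[OF c'(3,4)] p_nonneg
        by (cases "p x = p y"; simp add: r_def)+
      then show ?thesis using c' by auto
    qed
    ultimately show "\<exists>b>x. r ` {x..<b} \<subseteq> {r x..<c}" by blast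
  next
    fix x b :: real assume b: "x < b"
    define b' where "b' = min (real_of_int \<lfloor>x\<rfloor> + 1) b"
    define c where "c = h (p x + (b' - x))"
    have "x < b'" using b by (simp add: b'_def)
    then have "r x < c" using p_nonneg by (auto simp: c_def r_def intro: h_mono)
    moreover have "w \<in> r ` {x..<b}" if w: "w \<in> {r x..<c}" for w
    proof -
      have w': "t \<le> w" "w < d"
        using w h_range[OF p_nonneg[of x]] h_range[of "p x + (b' - x)"] p_nonneg[of x] \<open>x < b'\<close>
        by (auto simp: r_def c_def)
      define y where "y = x + (h' w - p x)"
      have "p x \<le> h' w"
        using h_mono[of "h' w" "p x"] h_h'[OF w'] w by (force simp: r_def)
      moreover have "h' w < p x + (b' - x)"
        using h_less[of "h' w" "p x + (b' - x)"] h_h'[OF w'] w p_nonneg[of x] \<open>x < b'\<close>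
        by (auto simp: c_def)
      ultimately have y: "x \<le> y" "y < b'" by (auto simp: y_def)
      then have "p y = h' w" using p_translate[of x y] by (auto simp: y_def b'_def)
      then have "r y = w" using h_h'[OF w'] by (simp add: r_def)
      then show ?thesis using y by (auto simp: b'_def)
    qed
    ultimately show "\<exists>c>r x. {r x..<c} \<subseteq> r ` {x..<b}" by blast
  qed
qed

section \<open>Right-continuous increasing maps into an uncountable set\<close>

text \<open>If the set is bounded, each member except the supremum lies below a rational that still
  has a countable initial part, and there are countably many rationals. If it is unbounded, all
  bounded initial parts of \<open>Z\<close> are countable.\<close>

lemma countable_initial:
  fixes Z :: "real set"
  shows "countable {c\<in>Z. a < c \<and> countable (Z \<inter> {a<..<c})}" (is "countable ?A")
proof (cases "bdd_above ?A")
  case True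
  have "?A \<subseteq> {Sup ?A} \<union> (\<Union>c\<in>{r\<in>\<rat>. countable (Z \<inter> {a<..<r})}. Z \<inter> {a<..<c})"
  proof
    fix x assume x: "x \<in> ?A"
    show "x \<in> {Sup ?A} \<union> (\<Union>c\<in>{r\<in>\<rat>. countable (Z \<inter> {a<..<r})}. Z \<inter> {a<..<c})"
    proof (cases "x = Sup ?A")
      case False
      then have "x < Sup ?A"
        using x True by (meson cSup_upper order_less_le)
      then obtain r where r: "r \<in> \<rat>" "x < r" "r < Sup ?A"
        using Rats_dense_in_real by blast
      then obtain c where "c \<in> ?A" "r < c"
        using x less_cSupD[of ?A r] by blast
      then have "countable (Z \<inter> {a<..<r})"
        using countable_subset[of "Z \<inter> {a<..<r}" "Z \<inter> {a<..<c}"] by fastforce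
      with r x show ?thesis by auto
    qed simp
  qed
  moreover have "countable ({Sup ?A} \<union> (\<Union>c\<in>{r\<in>\<rat>. countable (Z \<inter> {a<..<r})}. Z \<inter> {a<..<c}))"
  proof -
    have "countable {r\<in>\<rat>. countable (Z \<inter> {a<..<r})}"
      by (rule countable_subset[OF _ countable_rat]) auto
    from countable_UN[OF this, of "\<lambda>c. Z \<inter> {a<..<c}"] show ?thesis by simp
  qed
  ultimately show ?thesis
    using countable_subset by blast
next
  case False
  have "?A \<subseteq> (\<Union>n. Z \<inter> {a<..<real n})"
    using reals_Archimedean2 by auto
  moreover have "countable (Z \<inter> {a<..<real n})" for n
  proof -
    obtain c where "c \<in> ?A" "real n < c"
      using False unfolding bdd_above_def by (meson not_le)
    then show ?thesis
      using countable_subset[of "Z \<inter> {a<..<real n}" "Z \<inter> {a<..<c}"] by fastforce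
  qed
  ultimately show ?thesis
    by (meson countable_UN countable_subset countableI_type)
qed

text \<open>Only countably many points of \<open>Z\<close> have a countable part on the left, and by
  reflection the same holds on the right; uncountably many candidates remain.\<close>

lemma uncountable_split:
  fixes Z :: "real set"
  assumes "uncountable (Z \<inter> {a<..<b})"
  obtains c where "c \<in> Z" "uncountable (Z \<inter> {a<..<c})" "uncountable (Z \<inter> {c<..<b})"
proof -
  let ?A = "{c\<in>Z. a < c \<and> countable (Z \<inter> {a<..<c})}"
  let ?B = "{c\<in>Z. c < b \<and> countable (Z \<inter> {c<..<b})}"
  have "countable {c\<in>uminus ` Z. - b < c \<and> countable (uminus ` Z \<inter> {-b<..<c})}" (is "countable ?C")
    by (rule countable_initial)
  moreover have "?B \<subseteq> uminus ` ?C"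
  proof
    fix c assume c: "c \<in> ?B"
    have "uminus ` Z \<inter> {-b<..<-c} \<subseteq> uminus ` (Z \<inter> {c<..<b})"
      by auto
    then have "countable (uminus ` Z \<inter> {-b<..<-c})"
      using c by (blast intro: countable_subset countable_image)
    then show "c \<in> uminus ` ?C"
      using c by (intro image_eqI[of _ _ "- c"]) auto
  qed
  ultimately have "countable ?B"
    by (meson countable_image countable_subset)
  then have "uncountable ((Z \<inter> {a<..<b}) - (?A \<union> ?B))"
    using assms countable_initial[of Z a] by (intro uncountable_minus_countable countable_Un)
  then have "Z \<inter> {a<..<b} - (?A \<union> ?B) \<noteq> {}"
    using countable_empty by metis
  then obtain c where "c \<in> Z \<inter> {a<..<b} - (?A \<union> ?B)"
    by (meson ex_in_conv)
  then show ?thesis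
    using that by auto
qed

text \<open>The value at the dyadic rational \<open>k / 2 ^ n\<close>: even indices inherit the
  value of the previous level, odd ones are new midpoints filled by \<open>m\<close> from their two
  neighbours.\<close>

primrec dyadic_refine :: "(real \<Rightarrow> real \<Rightarrow> real) \<Rightarrow> real \<Rightarrow> real \<Rightarrow> nat \<Rightarrow> nat \<Rightarrow> real" where
  "dyadic_refine m a b 0 k = (if k = 0 then a else b)"
| "dyadic_refine m a b (Suc n) k =
    (let l = dyadic_refine m a b n (k div 2)
     in if even k then l else m l (dyadic_refine m a b n (Suc (k div 2))))"

text \<open>The value does not depend on how the dyadic rational is represented, so values of
  different levels can be compared at a common one.\<close>

lemma dyadic_refine_add: "dyadic_refine m a b (n + i) (2 ^ i * k) = dyadic_refine m a b n k"
  by (induction i) (simp_all add: mult.assoc Let_def)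

lemma dyadic_between:
  fixes x y :: real
  assumes "0 \<le> x" "x < y" "y \<le> 1"
  obtains n k :: nat where "x < k / 2 ^ n" "k / 2 ^ n < y" "0 < k" "k < 2 ^ n"
proof -
  obtain n where n: "(1/2) ^ n < (y - x)"
    using real_arch_pow_inv[of "y - x" "1/2"] assms by auto
  define k where "k = nat \<lfloor>x * 2 ^ n\<rfloor> + 1"
  have k: "real k = \<lfloor>x * 2 ^ n\<rfloor> + 1"
    using assms by (simp add: k_def)
  have "x * 2 ^ n < k" "k \<le> x * 2 ^ n + 1"
    unfolding k by linarith+
  moreover have "1 < (y - x) * 2 ^ n"
    using n by (simp add: power_one_over field_simps)
  ultimately have *: "x < k / 2 ^ n" "k / 2 ^ n < y"
    by (auto simp: field_simps)
  moreover have "real k < 2 ^ n"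
  proof -
    have "real k / 2 ^ n < 1" using * assms by linarith
    then show ?thesis by (simp add: divide_less_eq)
  qed
  then have "k < 2 ^ n"
    by (metis of_nat_less_iff of_nat_numeral of_nat_power)
  moreover have "0 < k" by (simp add: k_def)
  ultimately show ?thesis
    using that by blast
qed

text \<open>Splitting repeatedly gives an increasing map from the dyadic rationals into
  \<open>Z\<close>, apart from the two ends, with uncountably many points of \<open>Z\<close>
  between neighbours. Its limits from the right define \<open>e\<close>.\<close>

lemma uncountable_right_continuous_ladder:
  fixes Z :: "real set"
  assumes "uncountable Z"
  obtains e :: "real \<Rightarrow> real" where
    "\<And>x y. 0 \<le> x \<Longrightarrow> x < y \<Longrightarrow> y < 1 \<Longrightarrow> \<exists>z\<in>Z. e x < z \<and> z < e y"
    "\<And>x. 0 \<le> x \<Longrightarrow> x < 1 \<Longrightarrow> \<exists>z\<in>Z. e x < z"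
    "\<And>x c. 0 \<le> x \<Longrightarrow> x < 1 \<Longrightarrow> e x < c \<Longrightarrow> \<exists>y. x < y \<and> y < 1 \<and> e y < c"
proof -
  define U where "U a b \<longleftrightarrow> uncountable (Z \<inter> {a<..<b})" for a b
  have less: "a < b" if "U a b" for a b
    using that unfolding U_def by (metis Int_empty_right countable_empty greaterThanLessThan_empty_iff not_le)
  have "Z \<subseteq> (\<Union>n. Z \<inter> {- real n<..<real n})"
  proof
    fix z assume "z \<in> Z"
    moreover obtain n where "\<bar>z\<bar> < real n" using reals_Archimedean2 by blast
    ultimately show "z \<in> (\<Union>n. Z \<inter> {- real n<..<real n})" by (auto intro!: exI[of _ n])
  qed
  then obtain N where "U (- real N) (real N)"
    using assms unfolding U_def by (meson countable_UN countable_subset countableI_type)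
  define m where "m a b = (SOME c. c \<in> Z \<and> U a c \<and> U c b)" for a b
  have m: "m a b \<in> Z \<and> U a (m a b) \<and> U (m a b) b" if ab: "U a b" for a b
  proof -
    obtain c where "c \<in> Z \<and> U a c \<and> U c b"
      using uncountable_split[OF ab[unfolded U_def]] unfolding U_def by metis
    then show ?thesis unfolding m_def by (rule someI)
  qed
  define q where "q = dyadic_refine m (- real N) (real N)"
  have U: "U (q n k) (q n (Suc k))" if "k < 2 ^ n" for n k
    using that
  proof (induction n arbitrary: k)
    case 0
    then show ?case using \<open>U (- real N) (real N)\<close> by (simp add: q_def)
  next
    case (Suc n)
    then have "U (q n (k div 2)) (q n (Suc (k div 2)))" by auto
    with m[OF this] show ?case by (auto simp: q_def Let_def)
  qed
  have Z: "q n k \<in> Z" if "0 < k" "k < 2 ^ n" for n k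
    using that
  proof (induction n arbitrary: k)
    case (Suc n)
    show ?case
    proof (cases "even k")
      case True
      with Suc show ?thesis by (auto simp: q_def Let_def elim!: evenE)
    next
      case False
      have "U (q n (k div 2)) (q n (Suc (k div 2)))" using Suc.prems by (intro U) auto
      with m[OF this] False show ?thesis by (simp add: q_def Let_def)
    qed
  qed simp
  have mono: "q n k < q n k'" if "k < k'" "k' \<le> 2 ^ n" for n k k'
    using that
  proof (induction k')
    case (Suc k')
    then show ?case
      using less[OF U[of k' n]] by (cases "k = k'") auto
  qed simp
  have qmono: "q n k < q n' k'" if "real k / 2 ^ n < real k' / 2 ^ n'" "k' < 2 ^ n'" for n n' k k'
  proof -
    have "q n k = q (n + n') (2 ^ n' * k)" "q n' k' = q (n + n') (2 ^ n * k')"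
      unfolding q_def by (metis dyadic_refine_add add.commute)+
    moreover have "real (2 ^ n' * k) < real (2 ^ n * k')"
      using that(1) by (simp add: field_simps)
    then have "2 ^ n' * k < 2 ^ n * k'" by (simp only: of_nat_less_iff)
    moreover have "2 ^ n * k' \<le> 2 ^ (n + n')" using that(2) by (simp add: power_add)
    ultimately show ?thesis using mono by metis
  qed
  \<comment> \<open>The strict inequality \<open>x <\<close> makes the infimum a limit from the
    right even at dyadic \<open>x\<close>.\<close>
  define S where "S x = {q n k | n k. k < 2 ^ n \<and> x < real k / 2 ^ n}" for x :: real
  define e where "e x = Inf (S x)" for x
  have bdd: "bdd_below (S x)" if "0 \<le> x" for x
  proof (rule bdd_belowI[of _ "q 0 0"])
    fix s assume "s \<in> S x"
    then obtain n k where "s = q n k" "k < 2 ^ n" "x < real k / 2 ^ n" by (auto simp: S_def)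
    then show "q 0 0 \<le> s" using that qmono[of 0 0 k n] by simp
  qed
  have ne: "S x \<noteq> {}" if x: "0 \<le> x" "x < 1" for x
  proof -
    obtain n k where "x < real k / 2 ^ n" "k < 2 ^ n"
      using dyadic_between[OF x order_refl] by blast
    then have "q n k \<in> S x" unfolding S_def by blast
    then show ?thesis by blast
  qed
  have upper: "e x < q n k" if kx: "0 \<le> x" "x < real k / 2 ^ n" "k < 2 ^ n" for x n k
  proof -
    have "real k / 2 ^ n \<le> 1" using kx(3) by (simp add: less_imp_le)
    then obtain n' k' where k': "x < real k' / 2 ^ n'" "real k' / 2 ^ n' < real k / 2 ^ n" "k' < 2 ^ n'"
      using dyadic_between[of x "real k / 2 ^ n"] kx by blast
    then have "e x \<le> q n' k'"
      unfolding e_def using bdd kx by (intro cInf_lower) (auto simp: S_def)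
    also have "\<dots> < q n k" using k' kx by (intro qmono)
    finally show ?thesis .
  qed
  have lower: "q n k \<le> e y" if "0 \<le> y" "y < 1" "real k / 2 ^ n \<le> y" for y n k
    unfolding e_def
  proof (rule cInf_greatest[OF ne])
    fix s assume "s \<in> S y"
    then obtain n' k' where "s = q n' k'" "k' < 2 ^ n'" "y < real k' / 2 ^ n'" by (auto simp: S_def)
    then show "q n k \<le> s" using that qmono[of k n k' n'] by simp
  qed (use that in auto)
  show ?thesis
  proof
    fix x y :: real assume xy: "0 \<le> x" "x < y" "y < 1"
    \<comment> \<open>Two dyadic rationals are used: the value at the first is strictly above
      \<open>e x\<close>, and the second separates it from \<open>e y\<close>, since
      \<open>lower\<close> is not strict.\<close>
    obtain n k where k: "x < real k / 2 ^ n" "real k / 2 ^ n < y" "0 < k" "k < 2 ^ n"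
      using dyadic_between[of x y] xy less_imp_le[OF xy(3)] by blast
    obtain n' k' where k': "real k / 2 ^ n < real k' / 2 ^ n'" "real k' / 2 ^ n' < y" "0 < k'" "k' < 2 ^ n'"
      using dyadic_between[of "real k / 2 ^ n" y] less_imp_le[OF xy(3)] k(2) by (metis divide_nonneg_nonneg of_nat_0_le_iff zero_le_numeral zero_le_power)
    have "q n k < q n' k'" using k' by (intro qmono)
    also have "\<dots> \<le> e y" using k' xy by (intro lower) auto
    finally show "\<exists>z\<in>Z. e x < z \<and> z < e y"
      using upper[of x k n] Z k xy by blast
  next
    fix x :: real assume x: "0 \<le> x" "x < 1"
    then obtain n k where "x < real k / 2 ^ n" "0 < k" "k < 2 ^ n"
      using dyadic_between[of x 1] by blast
    then show "\<exists>z\<in>Z. e x < z" using upper Z x by blast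
  next
    fix x c :: real assume x: "0 \<le> x" "x < 1" "e x < c"
    then obtain s where "s \<in> S x" "s < c"
      unfolding e_def using ne by (metis cInf_lessD)
    then obtain n k where k: "q n k < c" "k < 2 ^ n" "x < real k / 2 ^ n" by (auto simp: S_def)
    have "real k / 2 ^ n \<le> 1" using k(2) by (simp add: less_imp_le)
    then obtain y where y: "x < y" "y < real k / 2 ^ n" "y < 1"
      using dense[OF k(3)] by (meson order_less_le_trans)
    then have "e y < q n k" using upper k x by simp
    with y k show "\<exists>y. x < y \<and> y < 1 \<and> e y < c" by (intro exI[of _ y]) auto
  qed
qed

section \<open>Embedded Sorgenfrey intervals and their closure\<close>

text \<open>These are the properties of \<open>f \<circ> e\<close> that the topological argument
  uses. The sets \<open>V k\<close> recover the order of the parameter from open sets, and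
  \<open>closure_V\<close> carries this control over to limit points of the tails.\<close>

locale sorgenfrey_ladder =
  fixes X :: "'a topology" and g :: "real \<Rightarrow> 'a" and V :: "real \<Rightarrow> 'a set"
  assumes regular: "regular_space X" and t1: "t1_space X"
    and g_in: "g ` {0..<1} \<subseteq> topspace X"
    and right_continuous:
      "\<And>x U. \<lbrakk>x \<in> {0..<1}; openin X U; g x \<in> U\<rbrakk> \<Longrightarrow> \<exists>d>x. d < 1 \<and> g ` {x..<d} \<subseteq> U"
    and V_open: "\<And>k. k \<in> {0..<1} \<Longrightarrow> openin X (V k)"
    and V_antimono: "\<And>k k'. \<lbrakk>0 \<le> k; k \<le> k'; k' < 1\<rbrakk> \<Longrightarrow> V k' \<subseteq> V k"
    and g_in_V: "\<And>x k. \<lbrakk>x \<in> {0..<1}; k \<in> {0..<1}\<rbrakk> \<Longrightarrow> g x \<in> V k \<longleftrightarrow> k \<le> x"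
    and closure_V: "\<And>k k'. \<lbrakk>0 \<le> k; k < k'; k' < 1\<rbrakk> \<Longrightarrow> X closure_of (g ` {k'..<1}) \<subseteq> V k"
begin

section \<open>Cuts of points in the closure of the ladder\<close>

definition A :: "'a set" where "A = X closure_of (g ` {0..<1})"

text \<open>By \<open>V_antimono\<close> this is an initial segment of the unit interval: the
  position of \<open>y\<close> relative to the ladder.\<close>

definition cut :: "'a \<Rightarrow> real set" where "cut y = {k\<in>{0..<1}. y \<in> V k}"

lemma g_in_A: "x \<in> {0..<1} \<Longrightarrow> g x \<in> A"
  unfolding A_def using closure_of_subset[OF g_in] by blast

lemma A_topspace: "A \<subseteq> topspace X"
  by (simp add: A_def closure_of_subset_topspace)

lemma inj_g: "inj_on g {0..<1}"
  by (rule inj_onI) (metis g_in_V order_antisym order_refl)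

lemma cut_g: "k \<in> {0..<1} \<Longrightarrow> cut (g k) = {0..k}"
  using g_in_V by (auto simp: cut_def)

text \<open>The set \<open>V\<close> at the midpoint of \<open>s\<close> and \<open>k\<close>
  contains the closure of the tail but not \<open>g s\<close>.\<close>

lemma not_in_closure_g:
  assumes "0 \<le> s" "s < k" "k < 1"
  shows "g s \<notin> X closure_of (g ` {k..<1})"
proof
  assume "g s \<in> X closure_of (g ` {k..<1})"
  then have "g s \<in> V ((s + k) / 2)"
    using closure_V[of "(s + k) / 2" k] assms by auto
  then show False
    using g_in_V[of s "(s + k) / 2"] assms by auto
qed

text \<open>The open set \<open>V k\<close> meets the image of \<open>g\<close> in the tail from
  \<open>k\<close> only, so points of the closure inside \<open>V k\<close> are limits of that
  tail.\<close>

lemma A_Int_V: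
  assumes "k \<in> {0..<1}"
  shows "A \<inter> V k \<subseteq> X closure_of (g ` {k..<1})"
proof -
  have "V k \<inter> A \<subseteq> X closure_of (V k \<inter> g ` {0..<1})"
    unfolding A_def by (rule openin_Int_closure_of_subset[OF V_open[OF assms]])
  also have "V k \<inter> g ` {0..<1} \<subseteq> g ` {k..<1}"
    using g_in_V assms by auto
  then have "X closure_of (V k \<inter> g ` {0..<1}) \<subseteq> X closure_of (g ` {k..<1})"
    by (rule closure_of_mono)
  finally show ?thesis by blast
qed

lemma Hausdorff: "Hausdorff_space X"
  using regular t1 by (simp add: regular_t1_imp_Hausdorff_space)

text \<open>Hausdorff separation of \<open>y\<close> from \<open>g i\<close> handles a short piece
  \<open>{i..<d}\<close>; the closure of the rest lies in some \<open>V k\<close> with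
  \<open>k > i\<close>, which misses \<open>y\<close>.\<close>

lemma not_in_closure_tail:
  assumes y: "y \<in> topspace X" "y \<notin> g ` {0..<1}" and i: "i \<in> {0..<1}"
    and gap: "\<And>k. \<lbrakk>i < k; k < 1\<rbrakk> \<Longrightarrow> y \<notin> V k"
  shows "y \<notin> X closure_of (g ` {i..<1})"
proof
  assume cl: "y \<in> X closure_of (g ` {i..<1})"
  have "g i \<in> topspace X" "g i \<noteq> y"
    using g_in y i by auto
  then obtain U W where UW: "openin X U" "openin X W" "y \<in> U" "g i \<in> W" "disjnt U W"
    using Hausdorff y(1) unfolding Hausdorff_space_def by metis
  then obtain d where d: "d > i" "d < 1" "g ` {i..<d} \<subseteq> W"
    using right_continuous[OF i] by blast
  have "U \<inter> g ` {i..<d} = {}"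
    using UW(5) d(3) by (auto simp: disjnt_iff)
  then have "y \<notin> X closure_of (g ` {i..<d})"
    using UW(1,3) by (auto simp: in_closure_of)
  moreover have "y \<notin> X closure_of (g ` {d..<1})"
    using closure_V[of "(i + d) / 2" d] gap[of "(i + d) / 2"] d i by auto
  moreover have "{i..<1} = {i..<d} \<union> {d..<1}"
    using d by auto
  ultimately show False
    using cl by (metis UnE closure_of_Un image_Un)
qed

text \<open>A largest \<open>k\<close> would put \<open>y\<close> into \<open>V k\<close>, hence
  into the closure of the tail from \<open>k\<close>, while no later \<open>V k'\<close> contains
  \<open>y\<close>.\<close>

lemma cut_no_max:
  assumes "y \<in> A" "y \<notin> g ` {0..<1}" "k \<in> {0..<1}"
  shows "cut y \<noteq> {0..k}"
proof
  assume cut: "cut y = {0..k}"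
  have "y \<in> topspace X"
    using assms(1) A_topspace by blast
  moreover have "y \<notin> V k'" if "k < k'" "k' < 1" for k'
  proof
    assume "y \<in> V k'"
    then have "k' \<in> cut y" using that assms(3) by (simp add: cut_def)
    then show False using that(1) by (simp add: cut)
  qed
  ultimately have "y \<notin> X closure_of (g ` {k..<1})"
    using not_in_closure_tail[OF _ assms(2,3)] by simp
  moreover have "k \<in> cut y"
    using assms(3) by (simp add: cut)
  then have "y \<in> V k"
    by (simp add: cut_def)
  ultimately show False
    using A_Int_V[OF assms(3)] assms(1) by blast
qed

text \<open>Let \<open>i\<close> be the infimum of the parameters missing from the cut. The closure
  of the tail from \<open>i\<close> misses \<open>y\<close>, and it contains every point of
  \<open>A\<close> whose cut is larger.\<close>

lemma cut_upper_semicontinuous: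
  assumes "y \<in> A" "y \<notin> g ` {0..<1}"
  obtains N where "openin X N" "y \<in> N" "\<And>z. z \<in> N \<inter> A \<Longrightarrow> cut z \<subseteq> cut y"
proof (cases "{0..<1} - cut y = {}")
  case True
  have y: "y \<in> topspace X"
    using assms(1) A_topspace by blast
  show ?thesis
    by (rule that[OF openin_topspace y]) (use True in \<open>auto simp: cut_def\<close>)
next
  case False
  define i where "i = Inf ({0..<1} - cut y)"
  have bdd: "bdd_below ({0..<1} - cut y)"
    by (rule bdd_belowI[of _ 0]) auto
  have i: "i \<in> {0..<1}"
  proof -
    obtain k where k: "k \<in> {0..<1} - cut y" using False by blast
    have "i \<le> k" unfolding i_def by (rule cInf_lower[OF k bdd])
    moreover have "0 \<le> i" unfolding i_def using False by (intro cInf_greatest) auto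
    ultimately show ?thesis using k by auto
  qed
  have y: "y \<in> topspace X"
    using assms(1) A_topspace by blast
  have "y \<notin> V k" if ik: "i < k" "k < 1" for k
  proof -
    obtain k' where "k' \<in> {0..<1} - cut y" "k' < k"
      using cInf_lessD[OF False ik(1)[unfolded i_def]] by blast
    then show ?thesis
      using V_antimono[of k' k] ik by (auto simp: cut_def)
  qed
  then have ncl: "y \<notin> X closure_of (g ` {i..<1})"
    by (rule not_in_closure_tail[OF y assms(2) i])
  show ?thesis
  proof (rule that)
    show "openin X (topspace X - X closure_of (g ` {i..<1}))"
      by (intro openin_diff openin_topspace closedin_closure_of)
    show "y \<in> topspace X - X closure_of (g ` {i..<1})" using y ncl by blast
    fix z assume z: "z \<in> (topspace X - X closure_of (g ` {i..<1})) \<inter> A"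
    show "cut z \<subseteq> cut y"
    proof (rule ccontr)
      assume "\<not> cut z \<subseteq> cut y"
      then obtain k where k: "k \<in> cut z" "k \<notin> cut y" by blast
      then have k01: "k \<in> {0..<1}" by (auto simp: cut_def)
      then have "i \<le> k"
        unfolding i_def using k by (intro cInf_lower[OF _ bdd]) auto
      then have "X closure_of (g ` {k..<1}) \<subseteq> X closure_of (g ` {i..<1})"
        by (intro closure_of_mono image_mono) auto
      then show False
        using z k A_Int_V[OF k01] by (auto simp: cut_def)
    qed
  qed
qed

section \<open>Closed portions of the ladder\<close>

text \<open>Regularity shrinks \<open>N\<close> so that limit points of a short portion are values
  of \<open>g\<close>. Values before \<open>t\<close> are excluded by
  \<open>not_in_closure_g\<close>, values from \<open>d\<close> on by the sets
  \<open>V s\<close>.\<close>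

lemma closedin_initial_portion:
  assumes t: "t \<in> {0..<1}" and N: "openin X N" "g t \<in> N" "N \<inter> A \<subseteq> g ` {0..<1}"
  obtains d where "t < d" "d < 1" "closedin X (g ` {t..<d})"
proof -
  obtain N' where N': "openin X N'" "g t \<in> N'" "X closure_of N' \<subseteq> N"
    using regular_nhd[OF regular N(1,2)] by blast
  then obtain d where d: "t < d" "d < 1" "g ` {t..<d} \<subseteq> N'"
    using right_continuous[OF t] by blast
  have sub: "g ` {t..<d} \<subseteq> g ` {0..<1}" "g ` {t..<d} \<subseteq> g ` {t..<1}"
    using t d by auto
  have "X closure_of (g ` {t..<d}) \<subseteq> X closure_of N' \<inter> A"
    unfolding A_def using closure_of_mono[OF d(3)] closure_of_mono[OF sub(1)] by blast
  then have *: "X closure_of (g ` {t..<d}) \<subseteq> g ` {0..<1}"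
    using N' N by blast
  have "X closure_of (g ` {t..<d}) \<subseteq> g ` {t..<d}"
  proof
    fix y assume y: "y \<in> X closure_of (g ` {t..<d})"
    then obtain s where s: "s \<in> {0..<1}" "y = g s" using * by blast
    have "t \<le> s"
      using not_in_closure_g[of s t] closure_of_mono[OF sub(2)] y s t
      by (metis atLeastLessThan_iff not_le subsetD)
    moreover have "s < d"
    proof (rule ccontr)
      assume "\<not> s < d"
      then have "V s \<inter> g ` {t..<d} = {}"
        using g_in_V[of _ s] s t d by auto
      moreover have "openin X (V s)" "y \<in> V s"
        using V_open g_in_V s by auto
      ultimately show False
        using y unfolding in_closure_of by blast
    qed
    ultimately show "y \<in> g ` {t..<d}" using s by auto
  qed
  moreover have "g ` {t..<d} \<subseteq> topspace X" using sub(1) g_in by blast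
  ultimately show ?thesis
    using that d closure_of_subset_eq by blast
qed

lemma homeomorphic_initial_portion:
  assumes td: "0 \<le> t" "t < d" "d < 1"
  shows "subtopology X (g ` {t..<d}) homeomorphic_space subtopology sorgenfrey_line {t..<d}"
proof -
  let ?S = "subtopology sorgenfrey_line {t..<d}" and ?Y = "subtopology X (g ` {t..<d})"
  have sub: "{t..<d} \<subseteq> {0..<1}" using td by auto
  have gsub: "g ` {t..<d} \<subseteq> topspace X" using g_in sub by blast
  have "homeomorphic_map ?S ?Y g"
  proof (rule bijective_open_imp_homeomorphic_map)
    show "continuous_map ?S ?Y g"
      unfolding continuous_map_in_subtopology
    proof
      show "continuous_map ?S X g"
        unfolding continuous_map
      proof (intro conjI allI impI)
        fix U assume U: "openin X U"
        have "openin sorgenfrey_line {x \<in> {t..<d}. g x \<in> U}"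
          unfolding openin_sorgenfrey_line
        proof
          fix x assume x: "x \<in> {x \<in> {t..<d}. g x \<in> U}"
          then obtain c where "c > x" "g ` {x..<c} \<subseteq> U"
            using right_continuous[of x U] U sub by blast
          then show "\<exists>b>x. {x..<b} \<subseteq> {x \<in> {t..<d}. g x \<in> U}"
            using x by (intro exI[of _ "min c d"]) auto
        qed
        then show "openin ?S {x \<in> topspace ?S. g x \<in> U}"
          unfolding openin_subtopology by (intro exI[of _ "{x \<in> {t..<d}. g x \<in> U}"]) auto
      qed (use gsub in simp)
    qed simp
    show "open_map ?S ?Y g"
      unfolding open_map_def
    proof (intro allI impI)
      fix U assume "openin ?S U"
      then obtain T where T: "openin sorgenfrey_line T" "U = T \<inter> {t..<d}"
        unfolding openin_subtopology by blast
      have "\<exists>W. openin ?Y W \<and> y \<in> W \<and> W \<subseteq> g ` U" if yU: "y \<in> g ` U" for y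
      proof -
        obtain x where x: "x \<in> T" "t \<le> x" "x < d" "y = g x" using yU T(2) by auto
        then obtain b where b: "b > x" "{x..<b} \<subseteq> T"
          using T(1) unfolding openin_sorgenfrey_line by blast
        define c where "c = min b d"
        have c: "x < c" "c \<le> d" "{x..<c} \<subseteq> T" using b x by (auto simp: c_def)
        \<comment> \<open>The trace of \<open>W\<close> on the portion is the image of
          \<open>{x..<c}\<close>, which gives openness.\<close>
        define W where "W = V x - X closure_of (g ` {c..<1})"
        have "openin X W"
          unfolding W_def using V_open[of x] x td by (intro openin_diff) auto
        moreover have "y \<in> W"
          unfolding W_def using g_in_V[of x x] not_in_closure_g[of x c] x td c by auto
        moreover have "W \<inter> g ` {t..<d} \<subseteq> g ` U"
        proof
          fix w assume w: "w \<in> W \<inter> g ` {t..<d}"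
          then obtain s where s: "s \<in> {t..<d}" "w = g s" by blast
          have "x \<le> s"
            using w s g_in_V[of s x] x td unfolding W_def by auto
          moreover have "s < c"
          proof (rule ccontr)
            assume "\<not> s < c"
            then have "g s \<in> g ` {c..<1}" using s td by auto
            moreover have "g ` {c..<1} \<subseteq> topspace X" using g_in x td c by force
            ultimately show False
              using w s(2) closure_of_subset[of "g ` {c..<1}" X] unfolding W_def by auto
          qed
          ultimately show "w \<in> g ` U" using s c T(2) by auto
        qed
        ultimately show ?thesis
          using x by (intro exI[of _ "W \<inter> g ` {t..<d}"] conjI openin_subtopology_Int) auto
      qed
      then show "openin ?Y (g ` U)"
        by (subst openin_subopen) blast
    qed
    show "g ` topspace ?S = topspace ?Y"
      using gsub by auto
    show "inj_on g (topspace ?S)"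
      using inj_on_subset[OF inj_g sub] by simp
  qed
  then have "?S homeomorphic_space ?Y"
    by (rule homeomorphic_map_imp_homeomorphic_space)
  then show ?thesis
    by (rule iffD1[OF homeomorphic_space_sym])
qed

section \<open>Category argument on the preimage of the closure\<close>

text \<open>At \<open>g k\<close> the neighbourhood \<open>V k\<close> makes the cut locally
  smallest; off the image, upper semicontinuity makes it locally largest.\<close>

lemma cut_locally_monotone:
  assumes "y \<in> A"
  obtains N where "openin X N" "y \<in> N"
    "(\<forall>z\<in>N \<inter> A. cut y \<subseteq> cut z) \<or> (\<forall>z\<in>N \<inter> A. cut z \<subseteq> cut y)"
proof (cases "y \<in> g ` {0..<1}")
  case True
  then obtain k where k: "k \<in> {0..<1}" "y = g k" by blast
  have "cut y \<subseteq> cut z" if "z \<in> V k" for z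
  proof
    fix x assume "x \<in> cut y"
    then have "0 \<le> x" "x \<le> k" using cut_g[OF k(1)] k(2) by auto
    then show "x \<in> cut z" using that V_antimono[of x k] k(1) by (auto simp: cut_def)
  qed
  moreover have "y \<in> V k" using g_in_V k by auto
  ultimately show ?thesis using that[OF V_open[OF k(1)]] by blast
next
  case False
  then show ?thesis using cut_upper_semicontinuous[OF assms] that by metis
qed

lemma dense_g:
  assumes "openin X N" "y \<in> N" "y \<in> A"
  obtains x where "x \<in> {0..<1}" "g x \<in> N"
  using assms unfolding A_def in_closure_of by blast

lemma ex_locally_closed_point:
  assumes cont: "continuous_map sorgenfrey_line X f" and op: "open_map sorgenfrey_line X f"
    and surj: "range f = topspace X"
  obtains t N where "t \<in> {0..<1}" "openin X N" "g t \<in> N" "N \<inter> A \<subseteq> g ` {0..<1}"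
proof (rule ccontr)
  assume "\<not> thesis"
  then have dense_compl: "\<exists>y\<in>N \<inter> A. y \<notin> g ` {0..<1}" if "t \<in> {0..<1}" "openin X N" "g t \<in> N" for t N
    using that \<open>\<And>t N. \<lbrakk>t \<in> {0..<1}; openin X N; g t \<in> N; N \<inter> A \<subseteq> g ` {0..<1}\<rbrakk> \<Longrightarrow> thesis\<close> by blast
  have img_open: "openin X (f ` {a..<b})" for a b
    using op openin_sorgenfrey_line_atLeastLessThan unfolding open_map_def by blast
  define E where "E = {u. f u \<in> A}"
  have "closedin X A" by (simp add: A_def)
  then have E_closed: "closedin sorgenfrey_line E"
    using closedin_continuous_map_preimage[OF cont] unfolding E_def by fastforce
  have hit: "\<exists>t x. u \<le> t \<and> t < b \<and> x \<in> {0..<1} \<and> f t = g x \<and> t \<in> E" if "u \<in> E" "u < b" for u b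
  proof -
    obtain x where "x \<in> {0..<1}" "g x \<in> f ` {u..<b}"
      using dense_g[OF img_open[of u b], of "f u"] \<open>u \<in> E\<close> \<open>u < b\<close> unfolding E_def by auto
    then show ?thesis using g_in_A[of x] unfolding E_def by force
  qed
  have hit_other: "\<exists>t x'. t \<in> {u..<b} \<and> x' > x \<and> x' < 1 \<and> f t = g x' \<and> t \<in> E \<and> f t \<noteq> f u"
    if x: "x \<in> {0..<1}" "g x \<in> f ` {u..<b}" for u b x
  proof -
    obtain d where d: "d > x" "d < 1" "g ` {x..<d} \<subseteq> f ` {u..<b}"
      using right_continuous[OF x(1) img_open x(2)] by blast
    have *: "\<exists>t. t \<in> {u..<b} \<and> f t = g x' \<and> t \<in> E" if "x < x'" "x' < d" for x'
    proof -
      have "g x' \<in> f ` {u..<b}" using d(3) that by auto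
      then show ?thesis using g_in_A[of x'] x d that unfolding E_def by force
    qed
    \<comment> \<open>Two parameters are taken because \<open>g\<close> is injective: at least one
      of the values differs from \<open>f u\<close>.\<close>
    obtain x1 where x1: "x < x1" "x1 < d" using dense d(1) by blast
    obtain x2 where x2: "x1 < x2" "x2 < d" using dense x1(2) by blast
    have "g x1 \<noteq> g x2"
      using inj_g x1 x2 x d(2) unfolding inj_on_def by force
    then consider "g x1 \<noteq> f u" | "g x2 \<noteq> f u" by metis
    then show ?thesis
      using *[of x1] *[of x2] x1 x2 d(2) by (metis less_trans)
  qed
  have crowded: "\<exists>t\<in>E. u < t \<and> t < b" if ub: "u \<in> E" "u < b" for u b
  proof -
    obtain x where "x \<in> {0..<1}" "g x \<in> f ` {u..<b}"
      using hit[OF ub] by force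
    then obtain t where "t \<in> {u..<b}" "t \<in> E" "f t \<noteq> f u"
      using hit_other by meson
    then show ?thesis by (intro bexI[of _ t]) (auto simp: less_le)
  qed
  \<comment> \<open>Each of \<open>P n\<close>, \<open>Q n\<close> being dense in a portion of \<open>E\<close> makes \<open>cut \<circ> f\<close> monotone there, which
    is impossible, since both \<open>g ` {0..<1}\<close> and its complement are dense in \<open>A\<close>.\<close>
  define P where "P n = {u\<in>E. \<forall>t\<in>E. u \<le> t \<and> t < u + 1 / real (Suc n) \<longrightarrow> cut (f u) \<subseteq> cut (f t)}" for n
  define Q where "Q n = {u\<in>E. \<forall>t\<in>E. u \<le> t \<and> t < u + 1 / real (Suc n) \<longrightarrow> cut (f t) \<subseteq> cut (f u)}" for n
  \<comment> \<open>The families \<open>P\<close> and \<open>Q\<close> are interleaved into one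
    sequence, as the category lemma requires.\<close>
  define D where "D n = (if even n then P (n div 2) else Q (n div 2))" for n
  have E_cover: "E \<subseteq> (\<Union>n. D n)"
  proof
    fix u assume u: "u \<in> E"
    then obtain N where N: "openin X N" "f u \<in> N"
      "(\<forall>z\<in>N \<inter> A. cut (f u) \<subseteq> cut z) \<or> (\<forall>z\<in>N \<inter> A. cut z \<subseteq> cut (f u))"
      using cut_locally_monotone unfolding E_def by blast
    then obtain b where b: "b > u" "f ` {u..<b} \<subseteq> N"
      using sorgenfrey_nhd[OF cont N(1,2)] by blast
    then obtain n where n: "1 / real (Suc n) < b - u"
      using reals_Archimedean[of "b - u"] by (auto simp: inverse_eq_divide)
    then have "f t \<in> N \<inter> A" if "t \<in> E" "u \<le> t" "t < u + 1 / real (Suc n)" for t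
      using that b(2) unfolding E_def by auto
    with N(3) u have "u \<in> P n \<or> u \<in> Q n"
      unfolding P_def Q_def by blast
    then have "u \<in> D (2 * n) \<or> u \<in> D (2 * n + 1)" by (simp add: D_def)
    then show "u \<in> (\<Union>n. D n)" by blast
  qed
  have E_nonempty: "E \<noteq> {}"
  proof -
    have "g 0 \<in> range f" using g_in surj by force
    then show ?thesis using g_in_A[of 0] unfolding E_def by force
  qed
  obtain n a b where nab: "a \<in> E" "a < b"
    "\<And>u c. u \<in> E \<Longrightarrow> a \<le> u \<Longrightarrow> u < b \<Longrightarrow> u < c \<Longrightarrow> \<exists>d\<in>D n. u \<le> d \<and> d < c"
    by (rule sorgenfrey_baire[OF E_closed _ E_nonempty E_cover], erule (1) crowded, rule that)
  \<comment> \<open>The portion is made so short that the condition in \<open>P\<close> or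
    \<open>Q\<close> reaches from any of its points to every later one.\<close>
  define c where "c = min b (a + 1 / real (Suc (n div 2)))"
  have c: "a < c" "c \<le> b" "c \<le> a + 1 / real (Suc (n div 2))"
    using nab(2) by (auto simp: c_def)
  obtain t0 x0 where tx: "a \<le> t0" "t0 < c" "x0 \<in> {0..<1}" "f t0 = g x0" "t0 \<in> E"
    using hit[OF nab(1) c(1)] by blast
  show False
  proof (cases "even n")
    case True
    \<comment> \<open>Density supplies only points \<open>d\<close> of \<open>P\<close> just to the
      right of \<open>u\<close>; openness of \<open>V k\<close> passes \<open>k\<close> from
      \<open>u\<close> to \<open>d\<close>.\<close>
    have mono: "cut (f u) \<subseteq> cut (f t)" if ut: "u \<in> E" "t \<in> E" "a \<le> u" "u < t" "t < c" for u t
    proof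
      fix k assume k: "k \<in> cut (f u)"
      then have "openin X (V k)" "f u \<in> V k" using V_open by (auto simp: cut_def)
      then obtain e where e: "e > u" "f ` {u..<e} \<subseteq> V k"
        using sorgenfrey_nhd[OF cont] by blast
      then obtain d where d: "d \<in> D n" "u \<le> d" "d < min e t"
        using nab(3)[of u "min e t"] ut c by auto
      then have "k \<in> cut (f d)" using e k by (auto simp: cut_def)
      moreover have "cut (f d) \<subseteq> cut (f t)"
        using d ut c True unfolding D_def P_def by simp
      ultimately show "k \<in> cut (f t)" by blast
    qed
    have "\<exists>y\<in>f ` {a..<c} \<inter> A. y \<notin> g ` {0..<1}"
      by (rule dense_compl[OF tx(3) img_open]) (use tx in force)
    then obtain u where u: "u \<in> E" "a \<le> u" "u < c" "f u \<notin> g ` {0..<1}"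
      unfolding E_def by auto
    then obtain N where N: "openin X N" "f u \<in> N" "\<And>z. z \<in> N \<inter> A \<Longrightarrow> cut z \<subseteq> cut (f u)"
      using cut_upper_semicontinuous[of "f u"] unfolding E_def by blast
    then obtain e where e: "e > u" "f ` {u..<e} \<subseteq> N"
      using sorgenfrey_nhd[OF cont] by blast
    obtain t x where t: "u \<le> t" "t < min e c" "x \<in> {0..<1}" "f t = g x" "t \<in> E"
      using hit[of u "min e c"] u e by auto
    then have "t \<noteq> u" using u by auto
    \<comment> \<open>With the opposite inclusion near \<open>u\<close>, the cut of a point off the
      image equals that of \<open>g x\<close>, which has a largest element.\<close>
    then have "cut (f u) \<subseteq> cut (f t)" using mono[of u t] t u by auto
    moreover have "cut (f t) \<subseteq> cut (f u)"
    proof (rule N(3))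
      have "t \<in> {u..<e}" using t(1,2) by auto
      then show "f t \<in> N \<inter> A" using e(2) t(5) unfolding E_def by blast
    qed
    ultimately show False
      using cut_no_max[of "f u" x] cut_g[of x] u t unfolding E_def by auto
  next
    case False
    have "g x0 \<in> f ` {t0..<c}" using tx by force
    from hit_other[OF tx(3) this] obtain t x where
      t: "t \<in> {t0..<c}" "x0 < x" "x < 1" "f t = g x" "t \<in> E" "f t \<noteq> f t0"
      by blast
    then have "t \<noteq> t0" by auto
    with t have "t0 < t" by auto
    have x: "x \<in> {0..<1}" using t tx by auto
    \<comment> \<open>Near \<open>t0\<close> the values of \<open>f\<close> stay off the closure of
      the tail from \<open>x\<close>, but a nearby \<open>d\<close> in \<open>Q\<close> has a cut
      containing that of \<open>g x\<close>, so \<open>f d\<close> lies in this closure.\<close>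
    let ?N = "topspace X - X closure_of (g ` {x..<1})"
    have "f t0 \<in> ?N"
      using not_in_closure_g[of x0 x] tx t g_in by auto
    moreover have "openin X ?N"
      by (intro openin_diff openin_topspace closedin_closure_of)
    ultimately obtain e where e: "e > t0" "f ` {t0..<e} \<subseteq> ?N"
      using sorgenfrey_nhd[OF cont] by blast
    obtain d where d: "d \<in> D n" "t0 \<le> d" "d < min e t"
      using nab(3)[of t0 "min e t"] tx c e \<open>t0 < t\<close> by auto
    then have "d \<in> E" "d \<le> t \<and> t < d + 1 / real (Suc (n div 2)) \<Longrightarrow> cut (f t) \<subseteq> cut (f d)"
      using t(5) False unfolding D_def Q_def by auto
    moreover have "d \<le> t \<and> t < d + 1 / real (Suc (n div 2))"
      using t(1) c(3) tx(1) d(2,3) by auto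
    moreover have "x \<in> cut (f t)" using cut_g[OF x] t x by auto
    ultimately have "f d \<in> A \<inter> V x" unfolding E_def cut_def by auto
    moreover have "d \<in> {t0..<e}" using d by simp
    then have "f d \<in> ?N" using e(2) by blast
    ultimately show False
      using A_Int_V[OF x] by blast
  qed
qed

end

section \<open>Maps onto spaces of uncountable weight\<close>

text \<open>If \<open>f x' = f x\<close> for some \<open>x' > x\<close> close to \<open>x\<close>, then \<open>f ` {p..<q}\<close> with rational \<open>p\<close>
  between \<open>x\<close> and \<open>x'\<close> is a small neighbourhood of \<open>f x\<close>.\<close>

lemma second_countable_right_recurrent:
  assumes cont: "continuous_map sorgenfrey_line X f" and op: "open_map sorgenfrey_line X f"
    and surj: "range f = topspace X"
    and "countable {x. \<exists>d>x. f x \<notin> f ` {x<..<d}}" (is "countable ?W")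
  shows "second_countable X"
proof -
  define B where "B = (\<lambda>(p, q). f ` {p..<q}) ` ((\<rat> \<union> ?W) \<times> \<rat>)"
  have "countable B"
    unfolding B_def using assms(4) countable_rat by (intro countable_image countable_SIGMA countable_Un)
  moreover have "openin X V" if "V \<in> B" for V
    using that op openin_sorgenfrey_line_atLeastLessThan unfolding B_def open_map_def by auto
  moreover have "\<exists>V\<in>B. y \<in> V \<and> V \<subseteq> U" if U: "openin X U" "y \<in> U" for U y
  proof -
    have "y \<in> range f" using openin_subset[OF U(1)] U(2) surj by blast
    then obtain x where x: "y = f x" by blast
    then obtain b where b: "b > x" "f ` {x..<b} \<subseteq> U"
      using sorgenfrey_nhd[OF cont U(1)] U(2) by blast
    show ?thesis
    proof (cases "x \<in> ?W")
      case True
      obtain q where q: "q \<in> \<rat>" "x < q" "q < b" using Rats_dense_in_real[OF b(1)] by blast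
      then have "f ` {x..<q} \<in> B" unfolding B_def using True by (intro image_eqI[of _ _ "(x, q)"]) auto
      moreover have "f ` {x..<q} \<subseteq> U" using q b(2) by force
      moreover have "y \<in> f ` {x..<q}" using x q by simp
      ultimately show ?thesis by blast
    next
      case False
      then have "f x \<in> f ` {x<..<b}" using b(1) by simp
      then obtain x' where x': "x < x'" "x' < b" "f x = f x'" by auto
      obtain p where p: "p \<in> \<rat>" "x < p" "p < x'" using Rats_dense_in_real[OF x'(1)] by blast
      obtain q where q: "q \<in> \<rat>" "x' < q" "q < b" using Rats_dense_in_real[OF x'(2)] by blast
      have "f ` {p..<q} \<in> B" unfolding B_def using p q by (intro image_eqI[of _ _ "(p, q)"]) auto
      moreover have "f ` {p..<q} \<subseteq> U" using p q b(2) by force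
      moreover have "y \<in> f ` {p..<q}" using x x' p q by auto
      ultimately show ?thesis by blast
    qed
  qed
  ultimately show ?thesis
    unfolding second_countable_def by blast
qed

text \<open>Each exceptional point admits a rational \<open>M\<close> from openness of
  \<open>f\<close> and a rational \<open>M'\<close> from regularity. There are countably many pairs
  but uncountably many points, so one pair serves uncountably many.\<close>

lemma uncountable_separated_set:
  assumes cont: "continuous_map sorgenfrey_line X f" and op: "open_map sorgenfrey_line X f"
    and surj: "range f = topspace X" and reg: "regular_space X" and "\<not> second_countable X"
  obtains M M' :: real where "M' < M"
    "uncountable {z. z < M' \<and> f z \<notin> f ` {z<..<M} \<and> X closure_of (f ` {z..<M'}) \<subseteq> f ` {z..<M}}"
proof -
  define Z where "Z = (\<lambda>(M, M'). {z. z < M' \<and> f z \<notin> f ` {z<..<M} \<and>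
    X closure_of (f ` {z..<M'}) \<subseteq> f ` {z..<M}})"
  let ?I = "{(M, M'). M \<in> \<rat> \<and> M' \<in> \<rat> \<and> M' < M}"
  let ?W = "{x. \<exists>d>x. f x \<notin> f ` {x<..<d}}"
  have cover: "?W \<subseteq> (\<Union>i\<in>?I. Z i)"
  proof
    fix z assume "z \<in> ?W"
    then obtain d where d: "d > z" "f z \<notin> f ` {z<..<d}" by blast
    obtain M where M: "M \<in> \<rat>" "z < M" "M < d" using Rats_dense_in_real[OF d(1)] by blast
    have "openin X (f ` {z..<M})"
      using op openin_sorgenfrey_line_atLeastLessThan unfolding open_map_def by blast
    then obtain V where V: "openin X V" "f z \<in> V" "X closure_of V \<subseteq> f ` {z..<M}"
      using regular_nhd[OF reg, of "f ` {z..<M}" "f z"] M by auto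
    then obtain b where b: "b > z" "f ` {z..<b} \<subseteq> V"
      using sorgenfrey_nhd[OF cont] by blast
    obtain M' where M': "M' \<in> \<rat>" "z < M'" "M' < min b M"
      using Rats_dense_in_real[of z "min b M"] b M by auto
    have "f ` {z..<M'} \<subseteq> V" using b(2) M' by force
    then have "X closure_of (f ` {z..<M'}) \<subseteq> f ` {z..<M}"
      using V(3) closure_of_mono by blast
    moreover have "f z \<notin> f ` {z<..<M}" using d(2) M by auto
    ultimately have "z \<in> Z (M, M')" using M' unfolding Z_def by auto
    then show "z \<in> (\<Union>i\<in>?I. Z i)" using M M' by (intro UN_I[of "(M, M')"]) auto
  qed
  have W: "uncountable ?W"
    using second_countable_right_recurrent[OF cont op surj] assms(5) by blast
  have I: "countable ?I"
    by (rule countable_subset[of _ "\<rat> \<times> \<rat>"]) (auto intro: countable_SIGMA countable_rat)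
  have "\<not> (\<forall>i\<in>?I. countable (Z i))"
  proof
    assume "\<forall>i\<in>?I. countable (Z i)"
    then have "countable (\<Union>i\<in>?I. Z i)"
      by (intro countable_UN[OF I]) (rule bspec)
    then show False
      by (rule notE[OF W countable_subset[OF cover]])
  qed
  then obtain i where "i \<in> ?I" "uncountable (Z i)"
    by blast
  then show ?thesis
    using that unfolding Z_def by (cases i) auto
qed

theorem theorem3p4:
  fixes X :: "'a topology" and f :: "real \<Rightarrow> 'a"
  assumes "regular_space X"
    and "t1_space X"
    and "continuous_map sorgenfrey_line X f"
    and "open_map sorgenfrey_line X f"
    and "f ` topspace sorgenfrey_line = topspace X"
    and "\<not> second_countable X"
  shows "\<exists>C. closedin X C \<and> subtopology X C homeomorphic_space sorgenfrey_line"
proof -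
  have surj: "range f = topspace X" using assms(5) by simp
  have img_open: "openin X (f ` {a..<b})" for a b
    using assms(4) openin_sorgenfrey_line_atLeastLessThan unfolding open_map_def by blast
  obtain M M' where M: "M' < M"
    "uncountable {z. z < M' \<and> f z \<notin> f ` {z<..<M} \<and> X closure_of (f ` {z..<M'}) \<subseteq> f ` {z..<M}}"
    (is "uncountable ?Z")
    by (rule uncountable_separated_set[OF assms(3,4) surj assms(1,6)])
  obtain e :: "real \<Rightarrow> real" where
    between: "\<And>x y. 0 \<le> x \<Longrightarrow> x < y \<Longrightarrow> y < 1 \<Longrightarrow> \<exists>z\<in>?Z. e x < z \<and> z < e y"
    and above: "\<And>x. 0 \<le> x \<Longrightarrow> x < 1 \<Longrightarrow> \<exists>z\<in>?Z. e x < z"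
    and right: "\<And>x c. 0 \<le> x \<Longrightarrow> x < 1 \<Longrightarrow> e x < c \<Longrightarrow> \<exists>y. x < y \<and> y < 1 \<and> e y < c"
    by (rule uncountable_right_continuous_ladder[OF M(2)]) (rule that; assumption)
  have e_mono: "e x < e y" if "0 \<le> x" "x < y" "y < 1" for x y
    using between[OF that] by auto
  have e_mono_le: "e x \<le> e y" if "0 \<le> x" "x \<le> y" "y < 1" for x y
    using e_mono[of x y] that by (cases "x = y") auto
  have e_less: "e x < M'" if "0 \<le> x" "x < 1" for x
    using above[OF that] by auto
  define V where "V k = f ` {e k..<M}" for k
  have V_mono: "V k' \<subseteq> V k" if "0 \<le> k" "k \<le> k'" "k' < 1" for k k'
    unfolding V_def using e_mono_le[OF that] by (intro image_mono) auto
  \<comment> \<open>By continuity, \<open>f\<close> would map points \<open>w\<close> of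
    \<open>?Z\<close> just to the right of \<open>e x\<close> into \<open>V k\<close>. Such a
    \<open>w\<close> lies below \<open>e k\<close>, so \<open>V k\<close> is part of the image of
    \<open>{w<..<M}\<close>, which \<open>f w\<close> avoids.\<close>
  have notin: "f (e x) \<notin> V k" if xk: "0 \<le> x" "x < k" "k < 1" for x k
  proof
    assume "f (e x) \<in> V k"
    then obtain b where b: "b > e x" "f ` {e x..<b} \<subseteq> V k"
      using sorgenfrey_nhd[OF assms(3) img_open] unfolding V_def by blast
    then obtain y where y: "x < y" "e y < b" "y < 1"
      using right[of x b] xk by auto
    \<comment> \<open>The minimum keeps \<open>z\<close> below both \<open>e k\<close> and
      \<open>b\<close>.\<close>
    have "x < min y k" "min y k < 1" using xk y by auto
    then obtain z where z: "z \<in> ?Z" "e x < z" "z < e (min y k)"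
      using between[OF xk(1)] by meson
    obtain z' where z': "z' \<in> ?Z" "e x < z'" "z' < z"
    proof -
      obtain y' where y': "x < y'" "y' < 1" "e y' < z" using right[OF _ _ z(2)] xk by auto
      then show ?thesis using between[of x y'] xk that by force
    qed
    have less: "z < e k" "z < b"
      using z(3) e_mono_le[of "min y k" k] e_mono_le[of "min y k" y] xk y by auto
    have same: "f w = f (e k)" if w: "w \<in> ?Z" "e x < w" "w < e k" "w < b" for w
    proof -
      have "f w \<in> f ` {e k..<M}" using b(2) w unfolding V_def by auto
      moreover have "f w \<notin> f ` {w<..<M}" using w by blast
      moreover have "e k < M" using e_less[of k] M(1) xk by simp
      ultimately show ?thesis using w(3) by auto
    qed
    have "f z' = f z" using same[of z] same[of z'] z z' less by auto
    moreover have "z < M" using z(1) M(1) by auto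
    ultimately show False using z'(1,3) by auto
  qed
  interpret sorgenfrey_ladder X "f \<circ> e" V
  proof
    show "regular_space X" "t1_space X" by fact+
    show "(f \<circ> e) ` {0..<1} \<subseteq> topspace X" using surj by auto
    show "openin X (V k)" for k using img_open by (simp add: V_def)
    show "V k' \<subseteq> V k" if "0 \<le> k" "k \<le> k'" "k' < 1" for k k' using V_mono that .
    show "(f \<circ> e) x \<in> V k \<longleftrightarrow> k \<le> x" if xk: "x \<in> {0..<1}" "k \<in> {0..<1}" for x k
    proof
      assume "(f \<circ> e) x \<in> V k"
      then show "k \<le> x" using notin[of x k] xk by force
    next
      assume "k \<le> x"
      then have "e k \<le> e x" "e x < M" using e_mono_le[of k x] e_less[of x] M(1) xk by auto
      then show "(f \<circ> e) x \<in> V k" by (auto simp: V_def)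
    qed
    show "X closure_of ((f \<circ> e) ` {k'..<1}) \<subseteq> V k" if kk: "0 \<le> k" "k < k'" "k' < 1" for k k'
    proof -
      \<comment> \<open>The closure condition holds only at points of \<open>?Z\<close>; a
        \<open>z\<close> between the two ladder points transfers it to \<open>V k\<close>.\<close>
      obtain z where z: "z \<in> ?Z" "e k < z" "z < e k'" using between[OF kk] by blast
      have "e x \<in> {z..<M'}" if "x \<in> {k'..<1}" for x
        using e_mono_le[of k' x] e_less[of x] that kk z by auto
      then have "(f \<circ> e) ` {k'..<1} \<subseteq> f ` {z..<M'}" by auto
      then have "X closure_of ((f \<circ> e) ` {k'..<1}) \<subseteq> f ` {z..<M}"
        using z(1) closure_of_mono by blast
      also have "\<dots> \<subseteq> V k" unfolding V_def using z(2) by (intro image_mono) auto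
      finally show ?thesis .
    qed
    show "\<exists>d>x. d < 1 \<and> (f \<circ> e) ` {x..<d} \<subseteq> U"
      if x: "x \<in> {0..<1}" and U: "openin X U" "(f \<circ> e) x \<in> U" for x U
    proof -
      obtain b where b: "b > e x" "f ` {e x..<b} \<subseteq> U"
        using sorgenfrey_nhd[OF assms(3) U(1)] U(2) by auto
      then obtain d where d: "x < d" "d < 1" "e d < b" using right[of x b] x by auto
      have "e y \<in> {e x..<b}" if "y \<in> {x..<d}" for y
        using e_mono_le[of x y] e_mono[of y d] that d x by auto
      then show ?thesis using d b(2) by (intro exI[of _ d]) auto
    qed
  qed
  obtain t N where t: "t \<in> {0..<1}" and N: "openin X N" "(f \<circ> e) t \<in> N" "N \<inter> A \<subseteq> (f \<circ> e) ` {0..<1}"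
    using ex_locally_closed_point[OF assms(3,4) surj] by blast
  then obtain d where d: "t < d" "d < 1" "closedin X ((f \<circ> e) ` {t..<d})"
    using closedin_initial_portion by blast
  have "subtopology X ((f \<circ> e) ` {t..<d}) homeomorphic_space subtopology sorgenfrey_line {t..<d}"
    using homeomorphic_initial_portion t d by simp
  also have "subtopology sorgenfrey_line {t..<d} homeomorphic_space sorgenfrey_line"
    using sorgenfrey_line_homeomorphic_atLeastLessThan[OF d(1)] homeomorphic_space_sym by blast
  finally show ?thesis using d(3) by blast
qed

end
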